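(* Let $I=[-1,1]$, let $T_1,T_2:I\to I$ be continuous, and let $\mu$ be a $T_1$-invariant Borel probability measure. For $k\in[0,1]$ let $\rho^{(k)}$ be a probability measure on $I^2$ invariant under $$\Theta^{(k)}(x,y)=\big(T_1(x),\,(1-k)T_2(y)+kT_1(x)\big),$$ with first marginal $\mu$, and let $(\eta_1^{(k)},\eta_2^{(k)})$ be a random vector with law $\rho^{(k)}$. (i) As $k\uparrow1$, $(\eta_1^{(k)},\eta_2^{(k)})$ converges in distribution to the random vector $(\eta_1,\eta_2)$ such that, for every Borel set $A\subseteq I^2$, $\mathbb P\{(\eta_1,\eta_2)\in A\}=\mu(\{x\in I:(x,x)\in A\})$. In other words, the family of conditional probability distributions $\{\rho^{(k)}(\cdot\,|\,\eta_1),\ k\in[0,1]\}$ converges weakly, as $k\to1$, to the law of a degenerate random variable constantly equal to $\eta_1$, where $\eta_1$ has law $\mu$. (ii) Moreover, if $T_2$ admits a unique invariant probability measure $\bar\nu$, then, as $k\downarrow0$, $\rho^{(k)}$ converges weakly to $\mu\otimes\bar\nu$, that is, $\{\rho^{(k)}(\cdot\,|\,\eta_1),\ k\in[0,1]\}$ converges weakly to $\bar\nu$.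
   Context: For each $k$, $\rho^{(k)}(\cdot\,|\,x)$ denotes the regular conditional distribution of the second component given that the first equals $x$: it is a probability kernel on $I$ such that $\int_{I^2}f\,d\rho^{(k)}=\int_I\mu(dx)\int_I\rho^{(k)}(dy\,|\,x)f(x,y)$ for every $\rho^{(k)}$-integrable $f$. $\rho^{(k)}(\cdot\,|\,\eta_1)$ denotes this kernel evaluated at the random point $\eta_1$ with law $\mu$ (the first component, whose law $\mu$ does not depend on $k$). The limit law in (i) is the one the paper writes formally as $\int_A\mu\otimes\lambda(dx,dy)\,\delta(y-x)$, with $\lambda$ Lebesgue measure and $\delta$ the Dirac delta. *)

theory Defs
  imports "HOL-Probability.Probability"
begin

abbreviation I :: "real set" where
  "I \<equiv> {-1..1}"

abbreviation borel_on :: "'a::topological_space set \<Rightarrow> 'a measure" where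
  "borel_on S \<equiv> restrict_space borel S"

definition invariant_prob :: "'a::topological_space set \<Rightarrow> ('a \<Rightarrow> 'a) \<Rightarrow> 'a measure \<Rightarrow> bool" where
  "invariant_prob S T M \<longleftrightarrow>
     prob_space M \<and> sets M = sets (borel_on S) \<and> T \<in> M \<rightarrow>\<^sub>M M \<and> distr M M T = M"

definition Theta :: "(real \<Rightarrow> real) \<Rightarrow> (real \<Rightarrow> real) \<Rightarrow> real \<Rightarrow> real \<times> real \<Rightarrow> real \<times> real" where
  "Theta T1 T2 k = (\<lambda>(x, y). (T1 x, (1 - k) * T2 y + k * T1 x))"

(* The library's weak_conv_m only covers sequences of measures on the whole real line;
   here the measures live on the Borel sets of a subset S, and the index runs along a filter. *)
definition weak_conv_on ::
    "'a::topological_space set \<Rightarrow> ('i \<Rightarrow> 'a measure) \<Rightarrow> 'a measure \<Rightarrow> 'i filter \<Rightarrow> bool" where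
  "weak_conv_on S M L F \<longleftrightarrow>
     (\<forall>f :: 'a \<Rightarrow> real. continuous_on S f \<and> bounded (f ` S) \<longrightarrow>
        ((\<lambda>i. \<integral>x. f x \<partial>M i) \<longlongrightarrow> (\<integral>x. f x \<partial>L)) F)"

(* The limit is given by its law L, which is all that convergence in distribution depends on. *)
definition conv_in_distr_on ::
    "'a::topological_space set \<Rightarrow> ('i \<Rightarrow> 'w measure) \<Rightarrow> ('i \<Rightarrow> 'w \<Rightarrow> 'a) \<Rightarrow> 'a measure \<Rightarrow> 'i filter \<Rightarrow> bool" where
  "conv_in_distr_on S \<Omega> X L F \<longleftrightarrow>
     weak_conv_on S (\<lambda>i. distr (\<Omega> i) (borel_on S) (X i)) L F"

definition regular_cond_distr ::
    "real measure \<Rightarrow> (real \<times> real) measure \<Rightarrow> (real \<Rightarrow> real measure) \<Rightarrow> bool" where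
  "regular_cond_distr \<mu> \<rho> \<kappa> \<longleftrightarrow>
     \<kappa> \<in> borel_on I \<rightarrow>\<^sub>M prob_algebra (borel_on I) \<and>
     (\<forall>f :: real \<times> real \<Rightarrow> real. integrable \<rho> f \<longrightarrow>
        (\<integral>z. f z \<partial>\<rho>) = (\<integral>x. (\<integral>y. f (x, y) \<partial>\<kappa> x) \<partial>\<mu>))"

(* Almost sure weak convergence of the random measures K i (x), x distributed as mu, to L x.
   Each kernel K i is only determined up to a null set depending on i, and the index set is
   uncountable, so a single null set for the whole family would depend on the choice of versions.
   Quantifying over sequences first makes the notion independent of that choice. *)
definition kernels_conv_on ::
    "'a::topological_space set \<Rightarrow> 'b measure \<Rightarrow> ('i \<Rightarrow> 'b \<Rightarrow> 'a measure) \<Rightarrow> ('b \<Rightarrow> 'a measure)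
      \<Rightarrow> 'i filter \<Rightarrow> bool" where
  "kernels_conv_on S \<mu> K L F \<longleftrightarrow>
     (\<forall>s :: nat \<Rightarrow> 'i. filterlim s F sequentially \<longrightarrow>
        (AE x in \<mu>. weak_conv_on S (\<lambda>n. K (s n) x) (L x) sequentially))"

end

theory Submission
  imports Defs
begin

text \<open>
  In both limits the mass of \<open>\<rho> k\<close> collapses onto a graph \<open>y = g x\<close>, uniformly and not just in
  probability, which is what makes the conditional laws converge almost surely along sequences.
  As \<open>k\<close> tends to 1, the image of \<open>Theta T1 T2 k\<close> lies within \<open>2 * (1 - k)\<close> of the diagonal.
  As \<open>k\<close> tends to 0, observe that a continuous map of an interval has a fixed point, so unique
  ergodicity of \<open>T2\<close> forces \<open>\<nu>\<close> to be the point mass at the only fixed point \<open>p\<close> and excludes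
  2-cycles. If \<open>[a, b]\<close> is the essential range of the second coordinate, invariance gives
  \<open>[a, b]\<close> contained in the \<open>2 * k\<close>-neighbourhood of \<open>T2 [a, b]\<close>. Without 2-cycles, an interval
  contained in the convex hull of its image is \<open>{p}\<close>, and compactness turns this into
  \<open>a, b \<longlongrightarrow> p\<close>.
\<close>

section \<open>Borel sets of subspaces and disintegration of null sets\<close>

lemma space_borel_on [simp]: "space (borel_on S) = S"
  by (simp add: space_restrict_space)

text \<open>Second countability puts the Borel sets of a product into the product sigma-algebra.
  This lets \<open>\<rho> k\<close>, which lives on \<open>borel_on (I \<times> I)\<close>, meet
  results on sections and iterated integrals stated for \<open>\<Otimes>\<^sub>M\<close>.\<close>

lemma measurable_ident_borel_on_Times:
  fixes S :: "'a::second_countable_topology set" and T :: "'b::second_countable_topology set"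
  shows "(\<lambda>z. z) \<in> borel_on S \<Otimes>\<^sub>M borel_on T \<rightarrow>\<^sub>M borel_on (S \<times> T)"
proof (rule measurable_restrict_space2)
  have fst: "fst \<in> borel_on S \<Otimes>\<^sub>M borel_on T \<rightarrow>\<^sub>M borel"
    by (rule measurable_compose[OF measurable_fst measurable_restrict_space1]) simp
  have snd: "snd \<in> borel_on S \<Otimes>\<^sub>M borel_on T \<rightarrow>\<^sub>M borel"
    by (rule measurable_compose[OF measurable_snd measurable_restrict_space1]) simp
  show "(\<lambda>z. z) \<in> borel_on S \<Otimes>\<^sub>M borel_on T \<rightarrow>\<^sub>M borel"
    using measurable_Pair[OF fst snd] by (simp add: borel_prod)
qed (auto simp: space_pair_measure)

lemma measurable_borel_on_continuous_on:
  fixes f :: "'a::topological_space \<Rightarrow> 'b::topological_space"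
  assumes "continuous_on S f" "f ` S \<subseteq> T"
  shows "f \<in> borel_on S \<rightarrow>\<^sub>M borel_on T"
  using assms by (intro measurable_restrict_space2 borel_measurable_continuous_on_restrict) auto

lemma pred_borel_on_le:
  fixes f g :: "'a::topological_space \<Rightarrow> real"
  assumes "continuous_on S f" "continuous_on S g"
  shows "{x \<in> S. f x \<le> g x} \<in> sets (borel_on S)"
proof -
  have [measurable]: "f \<in> borel_measurable (borel_on S)" "g \<in> borel_measurable (borel_on S)"
    using assms by (auto intro: borel_measurable_continuous_on_restrict)
  have "{x \<in> space (borel_on S). f x \<le> g x} \<in> sets (borel_on S)" by measurable
  then show ?thesis by simp
qed

text \<open>The disintegration formula, applied to the indicator of the exceptional set
  \<open>A\<close>, shows that the sections of \<open>A\<close> have mean conditional probability 0.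
  These probabilities are nonnegative, so almost all of them vanish.\<close>

lemma AE_regular_cond_distr:
  assumes K: "regular_cond_distr \<mu> \<rho> \<kappa>"
    and \<mu>: "prob_space \<mu>" "sets \<mu> = sets (borel_on I)"
    and \<rho>: "prob_space \<rho>" "sets \<rho> = sets (borel_on (I \<times> I))"
    and P: "{z \<in> I \<times> I. P z} \<in> sets (borel_on (I \<times> I))" and AE: "AE z in \<rho>. P z"
  shows "AE x in \<mu>. AE y in \<kappa> x. P (x, y)"
proof -
  interpret \<mu>: prob_space \<mu> by fact
  interpret \<rho>: prob_space \<rho> by fact
  have sp: "space \<mu> = I" "space \<rho> = I \<times> I"
    using sets_eq_imp_space_eq[OF \<mu>(2)] sets_eq_imp_space_eq[OF \<rho>(2)] by simp_all
  have \<kappa>: "\<kappa> \<in> borel_on I \<rightarrow>\<^sub>M prob_algebra (borel_on I)"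
    using K by (simp add: regular_cond_distr_def)
  then have \<kappa>': "\<kappa> \<in> borel_on I \<rightarrow>\<^sub>M subprob_algebra (borel_on I)"
    by (rule measurable_prob_algebraD)
  define A where "A = {z \<in> I \<times> I. \<not> P z}"
  have "A = space (borel_on (I \<times> I)) - {z \<in> I \<times> I. P z}" by (auto simp: A_def)
  with P have A: "A \<in> sets (borel_on (I \<times> I))" by (metis sets.compl_sets)
  \<comment> \<open>Measurability of the section probabilities in \<open>x\<close> requires
    \<open>A\<close> as a member of the product sigma-algebra, not only as a Borel set of the
    square.\<close>
  have "(\<lambda>z. z) -` A \<inter> space (borel_on I \<Otimes>\<^sub>M borel_on I) \<in> sets (borel_on I \<Otimes>\<^sub>M borel_on I)"
    by (rule measurable_sets[OF measurable_ident_borel_on_Times A])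
  moreover have "(\<lambda>z. z) -` A \<inter> space (borel_on I \<Otimes>\<^sub>M borel_on I) = (SIGMA x:space (borel_on I). {y. (x, y) \<in> A})"
    by (auto simp: space_pair_measure A_def)
  ultimately have meas: "(\<lambda>x. measure (\<kappa> x) {y. (x, y) \<in> A}) \<in> borel_measurable (borel_on I)"
    using measure_measurable_subprob_algebra2[OF _ \<kappa>'] by simp
  have \<kappa>x: "prob_space (\<kappa> x)" "sets (\<kappa> x) = sets (borel_on I)" "space (\<kappa> x) = I" if "x \<in> I" for x
    using measurable_space[OF \<kappa>, of x] that
    by (auto simp: space_prob_algebra dest: sets_eq_imp_space_eq)
  have sec: "{y. (x, y) \<in> A} \<in> sets (borel_on I)" if "x \<in> I" for x
  proof -
    have "(\<lambda>y. (x, y)) -` A \<inter> space (borel_on I) \<in> sets (borel_on I)"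
      using that by (intro measurable_sets[OF measurable_borel_on_continuous_on A]) (auto intro!: continuous_intros)
    moreover have "(\<lambda>y. (x, y)) -` A \<inter> space (borel_on I) = {y. (x, y) \<in> A}"
      by (auto simp: A_def)
    ultimately show ?thesis by simp
  qed
  have meas0: "measure \<rho> A = 0"
    using AE A AE_iff_measurable[of A \<rho> P] \<rho> sp by (simp add: A_def measure_def)
  have int: "integrable \<rho> (indicator A :: _ \<Rightarrow> real)"
    using A \<rho> by (intro integrable_real_indicator) (auto simp: \<rho>.emeasure_eq_measure)
  have "0 = (\<integral>z. indicat_real A z \<partial>\<rho>)"
    using meas0 sp sets.sets_into_space[OF A] by (simp add: Int_absorb2)
  also have "(\<integral>z. indicat_real A z \<partial>\<rho>) = (\<integral>x. (\<integral>y. indicator A (x, y) \<partial>\<kappa> x) \<partial>\<mu>)"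
    using K int unfolding regular_cond_distr_def by blast
  also have "\<dots> = (\<integral>x. measure (\<kappa> x) {y. (x, y) \<in> A} \<partial>\<mu>)"
  proof (rule Bochner_Integration.integral_cong[OF refl])
    fix x assume "x \<in> space \<mu>"
    then have x: "x \<in> I" by (simp add: sp)
    have "(\<integral>y. indicator A (x, y) \<partial>\<kappa> x) = (\<integral>y. indicator {y. (x, y) \<in> A} y \<partial>\<kappa> x)"
      by (intro Bochner_Integration.integral_cong) (auto simp: indicator_def)
    also have "\<dots> = measure (\<kappa> x) {y. (x, y) \<in> A}"
      using sets.Int_space_eq2[of "{y. (x, y) \<in> A}" "\<kappa> x"] sec[OF x] \<kappa>x[OF x] by simp
    finally show "(\<integral>y. indicator A (x, y) \<partial>\<kappa> x) = measure (\<kappa> x) {y. (x, y) \<in> A}" .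
  qed
  finally have int0: "(\<integral>x. measure (\<kappa> x) {y. (x, y) \<in> A} \<partial>\<mu>) = 0" by simp
  have m\<mu>: "(\<lambda>x. measure (\<kappa> x) {y. (x, y) \<in> A}) \<in> borel_measurable \<mu>"
    using meas measurable_cong_sets[OF \<mu>(2) refl] by blast
  \<comment> \<open>A Bochner integral is 0 by convention when the integrand is not integrable. Only
    together with integrability does the value 0 force vanishing almost everywhere.\<close>
  have "integrable \<mu> (\<lambda>x. measure (\<kappa> x) {y. (x, y) \<in> A})"
  proof (rule \<mu>.integrable_const_bound[where B = 1, OF AE_I2 m\<mu>])
    fix x assume "x \<in> space \<mu>"
    then have "prob_space (\<kappa> x)" using \<kappa>x(1) sp(1) by blast
    then show "norm (measure (\<kappa> x) {y. (x, y) \<in> A}) \<le> 1" by (simp add: prob_space.prob_le_1)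
  qed
  from integral_nonneg_eq_0_iff_AE[OF this] int0
  have "AE x in \<mu>. measure (\<kappa> x) {y. (x, y) \<in> A} = 0" by simp
  with AE_space[of \<mu>] show ?thesis
  proof eventually_elim
    case (elim x)
    then have x: "x \<in> I" and 0: "measure (\<kappa> x) {y. (x, y) \<in> A} = 0" by (simp_all add: sp)
    interpret k: prob_space "\<kappa> x" by (rule \<kappa>x[OF x])
    show ?case
    proof (rule AE_I)
      show "{y \<in> space (\<kappa> x). \<not> P (x, y)} \<subseteq> {y. (x, y) \<in> A}"
        using x unfolding \<kappa>x(3)[OF x] by (simp add: A_def subset_iff)
      show "emeasure (\<kappa> x) {y. (x, y) \<in> A} = 0" using 0 by (simp add: k.emeasure_eq_measure)
      show "{y. (x, y) \<in> A} \<in> sets (\<kappa> x)" using sec[OF x] \<kappa>x(2)[OF x] by simp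
    qed
  qed
qed

section \<open>Weak convergence from uniform concentration on a graph\<close>

lemma (in prob_space) dist_integral_le_AE:
  fixes f g :: "'a \<Rightarrow> real"
  assumes f: "integrable M f" and g: "integrable M g" and le: "AE x in M. dist (f x) (g x) \<le> e"
  shows "dist (\<integral>x. f x \<partial>M) (\<integral>x. g x \<partial>M) \<le> e"
proof -
  have "norm (\<integral>x. f x - g x \<partial>M) \<le> (\<integral>x. norm (f x - g x) \<partial>M)"
    by (rule integral_norm_bound)
  also have "\<dots> \<le> (\<integral>x. e \<partial>M)"
    by (rule integral_mono_AE) (use f g le in \<open>auto simp: dist_real_def\<close>)
  finally show ?thesis using f g by (simp add: dist_real_def prob_space)
qed

text \<open>By uniform continuity on the compact square, replacing \<open>snd z\<close> by
  \<open>g (fst z)\<close> changes a test function only slightly. After the replacement the integral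
  depends on the first marginal alone, so it already equals the integral against the limit.\<close>

lemma weak_conv_on_concentrating:
  fixes S :: "'a::metric_space set" and g :: "'a \<Rightarrow> 'a"
  assumes S: "compact S" and g: "continuous_on S g" "g ` S \<subseteq> S"
    and M: "\<forall>\<^sub>F i in F. prob_space (M i) \<and> sets (M i) = sets (borel_on (S \<times> S)) \<and>
              distr (M i) (borel_on S) fst = \<mu>"
    and conc: "\<And>\<epsilon>. \<epsilon> > 0 \<Longrightarrow> \<forall>\<^sub>F i in F. AE z in M i. dist (snd z) (g (fst z)) \<le> \<epsilon>"
  shows "weak_conv_on (S \<times> S) M (distr \<mu> (borel_on (S \<times> S)) (\<lambda>x. (x, g x))) F"
  unfolding weak_conv_on_def
proof (intro allI impI tendstoI)
  fix f :: "'a \<times> 'a \<Rightarrow> real" and e :: real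
  assume f: "continuous_on (S \<times> S) f \<and> bounded (f ` (S \<times> S))" and e: "e > 0"
  have graph: "(\<lambda>x. (x, g x)) \<in> borel_on S \<rightarrow>\<^sub>M borel_on (S \<times> S)"
    using g by (intro measurable_borel_on_continuous_on continuous_intros) auto
  have fst: "fst \<in> borel_on (S \<times> S) \<rightarrow>\<^sub>M borel_on S"
    by (intro measurable_borel_on_continuous_on continuous_intros) auto
  have fm: "f \<in> borel_measurable (borel_on (S \<times> S))"
    using f by (intro borel_measurable_continuous_on_restrict) auto
  obtain B where B: "\<And>z. z \<in> S \<times> S \<Longrightarrow> norm (f z) \<le> B"
    using f by (auto simp: bounded_iff)
  have "uniformly_continuous_on (S \<times> S) f"
    using S f by (intro compact_uniformly_continuous compact_Times) auto
  then obtain d where "d > 0" and d: "\<And>z z'. z \<in> S \<times> S \<Longrightarrow> z' \<in> S \<times> S \<Longrightarrow> dist z' z < d \<Longrightarrow> dist (f z') (f z) < e / 2"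
    using e unfolding uniformly_continuous_on_def by (metis half_gt_zero)
  \<comment> \<open>Halving \<open>d\<close> turns the non-strict concentration bound into the
    strict one asked for by uniform continuity; \<open>e / 2\<close> does the same for the final
    estimate.\<close>
  have "\<forall>\<^sub>F i in F. AE z in M i. dist (snd z) (g (fst z)) \<le> d / 2"
    using \<open>d > 0\<close> by (intro conc) simp
  then show "\<forall>\<^sub>F i in F. dist (\<integral>z. f z \<partial>M i) (\<integral>z. f z \<partial>distr \<mu> (borel_on (S \<times> S)) (\<lambda>x. (x, g x))) < e"
    using M
  proof eventually_elim
    case (elim i)
    interpret prob_space "M i" using elim by simp
    have sets: "sets (M i) = sets (borel_on (S \<times> S))" using elim by simp
    have sp: "space (M i) = S \<times> S" using sets_eq_imp_space_eq[OF sets] by simp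
    have fst': "fst \<in> M i \<rightarrow>\<^sub>M borel_on S"
      using fst measurable_cong_sets[OF sets refl] by blast
    have f': "f \<in> borel_measurable (M i)"
      using fm measurable_cong_sets[OF sets refl] by blast
    define h where "h z = f (fst z, g (fst z))" for z :: "'a \<times> 'a"
    have h': "h \<in> borel_measurable (M i)"
      unfolding h_def by (rule measurable_compose[OF fst' measurable_compose[OF graph fm]])
    have gS: "x \<in> S \<Longrightarrow> g x \<in> S" for x using g by auto
    have \<mu>: "distr (M i) (borel_on S) fst = \<mu>" using elim by simp
    have graph': "(\<lambda>x. (x, g x)) \<in> distr (M i) (borel_on S) fst \<rightarrow>\<^sub>M borel_on (S \<times> S)"
      using graph by simp
    have if': "integrable (M i) f"
      by (rule integrable_const_bound[where B = B]) (use B sp f' in auto)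
    have ih: "integrable (M i) h"
      by (rule integrable_const_bound[where B = B]) (use B sp h' gS in \<open>auto simp: h_def\<close>)
    have "(\<integral>z. f z \<partial>distr \<mu> (borel_on (S \<times> S)) (\<lambda>x. (x, g x))) = (\<integral>x. f (x, g x) \<partial>distr (M i) (borel_on S) fst)"
      unfolding \<mu>[symmetric] by (rule integral_distr[OF graph' fm])
    also have "\<dots> = (\<integral>z. h z \<partial>M i)"
      unfolding h_def by (rule integral_distr[OF fst' measurable_compose[OF graph fm]])
    finally have eq: "(\<integral>z. f z \<partial>distr \<mu> (borel_on (S \<times> S)) (\<lambda>x. (x, g x))) = (\<integral>z. h z \<partial>M i)" .
    have "dist (\<integral>z. f z \<partial>M i) (\<integral>z. h z \<partial>M i) \<le> e / 2"
    proof (rule dist_integral_le_AE[OF if' ih])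
      have "AE z in M i. z \<in> space (M i)" by simp
      then show "AE z in M i. dist (f z) (h z) \<le> e / 2"
        using elim(1)
      proof eventually_elim
        case (elim z)
        have "dist (f (fst z, snd z)) (f (fst z, g (fst z))) < e / 2"
          by (rule d) (use elim \<open>d > 0\<close> gS in \<open>auto simp: sp dist_Pair_Pair\<close>)
        then show ?case by (simp add: h_def)
      qed
    qed
    then show ?case using eq e by simp
  qed
qed

lemma weak_conv_on_cong_eventually:
  assumes conv: "weak_conv_on S M L F" and eq: "\<forall>\<^sub>F i in F. M' i = M i"
  shows "weak_conv_on S M' L F"
  unfolding weak_conv_on_def
proof (intro allI impI)
  fix f :: "'a \<Rightarrow> real" assume "continuous_on S f \<and> bounded (f ` S)"
  with conv have "((\<lambda>i. \<integral>x. f x \<partial>M i) \<longlongrightarrow> (\<integral>x. f x \<partial>L)) F" by (simp add: weak_conv_on_def)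
  then show "((\<lambda>i. \<integral>x. f x \<partial>M' i) \<longlongrightarrow> (\<integral>x. f x \<partial>L)) F"
    by (rule Lim_transform_eventually) (use eq in \<open>eventually_elim; simp\<close>)
qed

text \<open>Continuity at \<open>p\<close> makes the test function almost everywhere close to
  \<open>f p\<close>, and the total mass is 1. This serves for the conditional laws at a fixed
  \<open>x\<close>, which concentrate at the single point \<open>g x\<close>.\<close>

lemma weak_conv_on_return:
  fixes S :: "'a::metric_space set"
  assumes p: "p \<in> S"
    and M: "\<forall>\<^sub>F i in F. prob_space (M i) \<and> sets (M i) = sets (borel_on S)"
    and conc: "\<And>\<epsilon>. \<epsilon> > 0 \<Longrightarrow> \<forall>\<^sub>F i in F. AE y in M i. dist y p \<le> \<epsilon>"
  shows "weak_conv_on S M (return (borel_on S) p) F"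
  unfolding weak_conv_on_def
proof (intro allI impI tendstoI)
  fix f :: "'a \<Rightarrow> real" and e :: real
  assume f: "continuous_on S f \<and> bounded (f ` S)" and e: "e > 0"
  have fm: "f \<in> borel_measurable (borel_on S)"
    using f by (intro borel_measurable_continuous_on_restrict) auto
  obtain B where B: "\<And>z. z \<in> S \<Longrightarrow> norm (f z) \<le> B"
    using f by (auto simp: bounded_iff)
  obtain d where "d > 0" and d: "\<And>y. y \<in> S \<Longrightarrow> dist y p < d \<Longrightarrow> dist (f y) (f p) < e / 2"
    using e f p unfolding continuous_on_iff by (metis half_gt_zero)
  have "\<forall>\<^sub>F i in F. AE y in M i. dist y p \<le> d / 2"
    using \<open>d > 0\<close> by (intro conc) simp
  then show "\<forall>\<^sub>F i in F. dist (\<integral>z. f z \<partial>M i) (\<integral>z. f z \<partial>return (borel_on S) p) < e"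
    using M
  proof eventually_elim
    case (elim i)
    interpret prob_space "M i" using elim by simp
    have sets: "sets (M i) = sets (borel_on S)" using elim by simp
    have sp: "space (M i) = S" using sets_eq_imp_space_eq[OF sets] by simp
    have f': "f \<in> borel_measurable (M i)"
      using fm measurable_cong_sets[OF sets refl] by blast
    have if': "integrable (M i) f"
      by (rule integrable_const_bound[where B = B]) (use B sp f' in auto)
    have "dist (\<integral>z. f z \<partial>M i) (\<integral>z. f p \<partial>M i) \<le> e / 2"
    proof (rule dist_integral_le_AE[OF if' integrable_const])
      have "AE z in M i. z \<in> space (M i)" by simp
      then show "AE z in M i. dist (f z) (f p) \<le> e / 2"
        using elim(1)
      proof eventually_elim
        case (elim z)
        then have "dist (f z) (f p) < e / 2"
          using \<open>d > 0\<close> by (intro d) (auto simp: sp)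
        then show ?case by simp
      qed
    qed
    then show ?case using e fm p by (simp add: integral_return prob_space)
  qed
qed

text \<open>A uniform bound under \<open>\<rho> i\<close> passes to almost every conditional law.
  Along one sequence there are only countably many pairs of a tolerance and an index, so their null
  sets merge into one.\<close>

lemma kernels_conv_on_concentrating:
  assumes \<mu>: "prob_space \<mu>" "sets \<mu> = sets (borel_on I)" and g: "continuous_on I g" "g ` I \<subseteq> I"
    and M: "\<forall>\<^sub>F i in F. prob_space (\<rho> i) \<and> sets (\<rho> i) = sets (borel_on (I \<times> I)) \<and>
              regular_cond_distr \<mu> (\<rho> i) (K i)"
    and conc: "\<And>\<epsilon>. \<epsilon> > 0 \<Longrightarrow> \<forall>\<^sub>F i in F. AE z in \<rho> i. dist (snd z) (g (fst z)) \<le> \<epsilon>"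
  shows "kernels_conv_on I \<mu> K (\<lambda>x. return (borel_on I) (g x)) F"
  unfolding kernels_conv_on_def
proof (intro allI impI)
  fix s :: "nat \<Rightarrow> _" assume s: "filterlim s F sequentially"
  have sp: "space \<mu> = I" using sets_eq_imp_space_eq[OF \<mu>(2)] by simp
  \<comment> \<open>\<open>Q m n\<close> does not involve \<open>x\<close>, so the intersection can
    run over all \<open>m\<close> and \<open>n\<close>: where \<open>Q m n\<close> fails, the
    implication below is void, and for each \<open>m\<close> it holds for all large
    \<open>n\<close>.\<close>
  define Q where "Q m n \<longleftrightarrow> (AE x in \<mu>. AE y in K (s n) x. dist y (g x) \<le> 1 / real (Suc m))" for m n
  have Q: "\<forall>\<^sub>F n in sequentially. Q m n" for m
  proof -
    have "\<forall>\<^sub>F i in F. AE z in \<rho> i. dist (snd z) (g (fst z)) \<le> 1 / real (Suc m)"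
      by (rule conc) simp
    then have "\<forall>\<^sub>F i in F. AE x in \<mu>. AE y in K i x. dist y (g x) \<le> 1 / real (Suc m)"
      using M
    proof eventually_elim
      case (elim i)
      have "continuous_on (I \<times> I) (\<lambda>z. g (fst z))"
        using g by (intro continuous_on_compose2[OF g(1)] continuous_intros) auto
      then have "{z \<in> I \<times> I. dist (snd z) (g (fst z)) \<le> 1 / real (Suc m)} \<in> sets (borel_on (I \<times> I))"
        by (intro pred_borel_on_le continuous_intros)
      from AE_regular_cond_distr[OF _ \<mu> _ _ this, of "\<rho> i" "K i"] elim show ?case by simp
    qed
    then show ?thesis unfolding Q_def using s unfolding filterlim_iff by blast
  qed
  have "AE x in \<mu>. \<forall>m n. Q m n \<longrightarrow> (AE y in K (s n) x. dist y (g x) \<le> 1 / real (Suc m))"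
    unfolding AE_all_countable by (auto simp: Q_def)
  then show "AE x in \<mu>. weak_conv_on I (\<lambda>n. K (s n) x) (return (borel_on I) (g x)) sequentially"
  proof (rule AE_mp, intro AE_I2 impI)
    fix x assume "x \<in> space \<mu>"
      and x: "\<forall>m n. Q m n \<longrightarrow> (AE y in K (s n) x. dist y (g x) \<le> 1 / real (Suc m))"
    then have xI: "x \<in> I" by (simp add: sp)
    show "weak_conv_on I (\<lambda>n. K (s n) x) (return (borel_on I) (g x)) sequentially"
    proof (rule weak_conv_on_return)
      show "g x \<in> I" using g(2) xI by blast
      have "\<forall>\<^sub>F i in F. prob_space (K i x) \<and> sets (K i x) = sets (borel_on I)"
        using M
      proof eventually_elim
        case (elim i)
        then have "K i \<in> borel_on I \<rightarrow>\<^sub>M prob_algebra (borel_on I)"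
          by (simp add: regular_cond_distr_def)
        from measurable_space[OF this, of x] xI show ?case by (simp add: space_prob_algebra)
      qed
      then show "\<forall>\<^sub>F n in sequentially. prob_space (K (s n) x) \<and> sets (K (s n) x) = sets (borel_on I)"
        using s unfolding filterlim_iff by blast
      fix \<epsilon> :: real assume "\<epsilon> > 0"
      then obtain m where m: "1 / real (Suc m) < \<epsilon>"
        using nat_approx_posE by blast
      from Q[of m] show "\<forall>\<^sub>F n in sequentially. AE y in K (s n) x. dist y (g x) \<le> \<epsilon>"
      proof eventually_elim
        case (elim n)
        with x have "AE y in K (s n) x. dist y (g x) \<le> 1 / real (Suc m)" by blast
        then show ?case by eventually_elim (use m in linarith)
      qed
    qed
  qed
qed

section \<open>Essential bounds and intervals that cover themselves\<close>

text \<open>The supremum of the almost sure lower bounds is itself one, being approached through the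
  countably many levels \<open>Sup L - 1 / real (Suc n)\<close>. The upper bound \<open>B\<close>
  keeps the supremum finite.\<close>

lemma essential_infimum_exists:
  fixes X :: "'a \<Rightarrow> real"
  assumes "prob_space M" "AE x in M. A \<le> X x" "AE x in M. X x \<le> B"
  obtains a where "AE x in M. a \<le> X x" "\<And>a'. AE x in M. a' \<le> X x \<Longrightarrow> a' \<le> a"
proof -
  interpret prob_space M by fact
  define L where "L = {a. AE x in M. a \<le> X x}"
  have bdd: "a \<le> B" if "a \<in> L" for a
  proof -
    from that have "AE x in M. a \<le> X x" by (simp add: L_def)
    \<comment> \<open>The inequality no longer involves \<open>x\<close>, and on a space of total
      mass 1 it then holds outright.\<close>
    with assms(3) have "AE x in M. a \<le> B" by eventually_elim simp
    then show ?thesis by simp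
  qed
  then have bdd': "bdd_above L" by (auto simp: bdd_above_def)
  have "L \<noteq> {}" using assms(2) by (auto simp: L_def)
  have "AE x in M. Sup L - 1 / real (Suc n) \<le> X x" for n
  proof -
    have "Sup L - 1 / real (Suc n) < Sup L" by simp
    then obtain a where "a \<in> L" "Sup L - 1 / real (Suc n) < a"
      using \<open>L \<noteq> {}\<close> bdd' by (meson less_cSup_iff)
    then have "AE x in M. a \<le> X x" by (simp add: L_def)
    then show ?thesis by eventually_elim (use \<open>Sup L - 1 / real (Suc n) < a\<close> in linarith)
  qed
  then have "AE x in M. \<forall>n. Sup L - 1 / real (Suc n) \<le> X x" by (simp add: AE_all_countable)
  then have "AE x in M. Sup L \<le> X x"
  proof eventually_elim
    case (elim x)
    show ?case
    proof (rule ccontr)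
      assume "\<not> Sup L \<le> X x"
      then obtain n where "1 / real (Suc n) < Sup L - X x" using nat_approx_posE[of "Sup L - X x"] by auto
      with elim[rule_format, of n] show False by linarith
    qed
  qed
  then show ?thesis
    by (rule that) (use bdd' in \<open>auto simp: L_def intro!: cSup_upper\<close>)
qed

lemma fixed_point_in_segment:
  fixes T :: "real \<Rightarrow> real"
  assumes "continuous_on {u..v} T" "u \<le> v"
    and "(u \<le> T u \<and> T v \<le> v) \<or> (T u \<le> u \<and> v \<le> T v)"
  shows "\<exists>q. u \<le> q \<and> q \<le> v \<and> T q = q"
proof -
  have c: "continuous_on {u..v} (\<lambda>x. T x - x)" by (intro continuous_intros assms)
  have "\<exists>q. u \<le> q \<and> q \<le> v \<and> T q - q = 0"
    using assms(3)
  proof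
    assume "u \<le> T u \<and> T v \<le> v" then show ?thesis
      by (intro IVT2'[OF _ _ assms(2) c]) auto
  next
    assume "T u \<le> u \<and> v \<le> T v" then show ?thesis
      by (intro IVT'[OF _ _ assms(2) c]) auto
  qed
  then show ?thesis by simp
qed

text \<open>The condition \<open>per\<close> covers fixed points and 2-cycles at once. If
  \<open>c \<le> d\<close>, fixed points on both outer sides of \<open>{c..d}\<close> squeeze it to
  \<open>p\<close>. If \<open>d < c\<close>, a fixed point of the second iterate to the left of
  \<open>p\<close> leads to a contradiction.\<close>

lemma expanding_interval_trivial:
  fixes T :: "real \<Rightarrow> real"
  assumes T: "continuous_on {l..u} T" "T ` {l..u} \<subseteq> {l..u}"
    and per: "\<And>x. x \<in> {l..u} \<Longrightarrow> T (T x) = x \<Longrightarrow> x = p"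
    and ord: "l \<le> a" "b \<le> u" "c \<in> {a..b}" "d \<in> {a..b}" and cd: "T c \<le> a" "b \<le> T d"
  shows "a = p \<and> b = p"
proof -
  have sub: "continuous_on {v..w} T" if "l \<le> v" "w \<le> u" for v w
    using that by (intro continuous_on_subset[OF T(1)]) auto
  have T2: "continuous_on {l..u} (\<lambda>x. T (T x))"
    using T by (intro continuous_on_compose2[OF T(1) T(1)]) auto
  have fp: "q = p" if "l \<le> q" "q \<le> u" "T q = q" for q
    using per[of q] that by auto
  have lu: "l \<le> T x" "T x \<le> u" if "l \<le> x" "x \<le> u" for x
    using T(2) that by (simp_all add: image_subset_iff)
  have bnd: "l \<le> c" "c \<le> u" "l \<le> d" "d \<le> u" "a \<le> c" "c \<le> b" "a \<le> d" "d \<le> b"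
    using ord by auto
  show ?thesis
  proof (cases "c \<le> d")
    case True
    \<comment> \<open>At the ends of \<open>{l..c}\<close> the map points inward:
      \<open>l \<le> T l\<close> because \<open>T\<close> preserves \<open>{l..u}\<close>, and
      \<open>T c \<le> a \<le> c\<close>. The segment \<open>{d..u}\<close> is symmetric.\<close>
    have "\<exists>q. l \<le> q \<and> q \<le> c \<and> T q = q"
      by (rule fixed_point_in_segment[OF sub]) (use bnd cd lu[of l] in linarith)+
    then obtain q where q: "l \<le> q" "q \<le> c" "T q = q" by blast
    have "\<exists>r. d \<le> r \<and> r \<le> u \<and> T r = r"
      by (rule fixed_point_in_segment[OF sub]) (use bnd cd lu[of u] in linarith)+
    then obtain r where r: "d \<le> r" "r \<le> u" "T r = r" by blast
    have "q = p" by (rule fp) (use q bnd in linarith)+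
    moreover have "r = p" by (rule fp) (use r bnd in linarith)+
    ultimately have "c = p" "d = p" using q r True by linarith+
    then show ?thesis using q r cd bnd \<open>q = p\<close> \<open>r = p\<close> by force
  next
    case False
    have "\<exists>q. d \<le> q \<and> q \<le> c \<and> T q = q"
      by (rule fixed_point_in_segment[OF sub]) (use bnd cd False in linarith)+
    then obtain q where q: "d \<le> q" "q \<le> c" "T q = q" by blast
    have "q = p" by (rule fp) (use q bnd in linarith)+
    \<comment> \<open>\<open>T\<close> reverses the sides of \<open>p\<close>: a preimage \<open>d'\<close> of \<open>c\<close> left of \<open>p\<close> has \<open>T (T d') \<le> a \<le> d'\<close>,
      which would give a 2-cycle in \<open>[l, d']\<close>.\<close>
    have "\<exists>d'. d \<le> d' \<and> d' \<le> p \<and> T d' = c"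
      by (rule IVT2'[OF _ _ _ sub]) (use q \<open>q = p\<close> bnd cd in auto)
    then obtain d' where d': "d \<le> d'" "d' \<le> p" "T d' = c" by blast
    have "\<exists>r. l \<le> r \<and> r \<le> d' \<and> T (T r) = r"
    proof (rule fixed_point_in_segment)
      show "continuous_on {l..d'} (\<lambda>x. T (T x))"
        by (rule continuous_on_subset[OF T2]) (use d' q \<open>q = p\<close> bnd in auto)
      show "l \<le> d'" using d' bnd by linarith
      show "l \<le> T (T l) \<and> T (T d') \<le> d' \<or> T (T l) \<le> l \<and> d' \<le> T (T d')"
        using lu[of "T l"] lu[of l] d' bnd cd by auto
    qed
    then obtain r where r: "l \<le> r" "r \<le> d'" "T (T r) = r" by blast
    have "r = p" using per[of r] r d' q \<open>q = p\<close> bnd by auto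
    \<comment> \<open>Here \<open>p = r \<le> d' \<le> p\<close>. Then \<open>c = T p = p\<close>
      and \<open>p = T c \<le> a \<le> d\<close>, against \<open>d < c\<close>.\<close>
    then have "d' = p" using r d' by auto
    then have "c = p" using d' q \<open>q = p\<close> by auto
    then have "a = p" using q \<open>q = p\<close> cd bnd by auto
    then show ?thesis using False bnd \<open>c = p\<close> by auto
  qed
qed

text \<open>Compactness makes the preceding rigidity quantitative: on the configurations that reach
  distance \<open>\<epsilon>\<close> from \<open>p\<close>, the defect of expansion is continuous
  and positive, hence bounded away from 0.\<close>

lemma almost_expanding_interval_small:
  fixes T :: "real \<Rightarrow> real"
  assumes T: "continuous_on {l..u} T" "T ` {l..u} \<subseteq> {l..u}"
    and per: "\<And>x. x \<in> {l..u} \<Longrightarrow> T (T x) = x \<Longrightarrow> x = p" and "\<epsilon> > 0"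
  obtains \<delta> where "\<delta> > 0"
    "\<And>a b c d. l \<le> a \<Longrightarrow> b \<le> u \<Longrightarrow> c \<in> {a..b} \<Longrightarrow> d \<in> {a..b} \<Longrightarrow> T c \<le> a + \<delta> \<Longrightarrow> b \<le> T d + \<delta> \<Longrightarrow>
       {a..b} \<subseteq> {p - \<epsilon>..p + \<epsilon>}"
proof -
  define C where "C = {l..u} \<times> {l..u} \<times> {l..u} \<times> {l..u}"
  \<comment> \<open>The bad configurations; the non-strict inequalities keep the set closed.\<close>
  define Q where "Q = C \<inter> {(a, b, c, d). a \<le> c \<and> c \<le> b \<and> a \<le> d \<and> d \<le> b \<and> (a \<le> p - \<epsilon> \<or> p + \<epsilon> \<le> b)}"
  \<comment> \<open>\<open>h \<le> \<delta>\<close> says exactly that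
    \<open>T c \<le> a + \<delta>\<close> and \<open>b \<le> T d + \<delta>\<close>.\<close>
  define h where "h = (\<lambda>(a, b, c, d). max (T c - a) (b - T d))"
  have "closed {(a, b, c, d). a \<le> c \<and> c \<le> b \<and> a \<le> d \<and> d \<le> b \<and> (a \<le> p - \<epsilon> \<or> p + \<epsilon> \<le> b)}"
    unfolding case_prod_beta
    by (intro closed_Collect_conj closed_Collect_disj closed_Collect_le continuous_intros)
  then have Q: "compact Q"
    unfolding Q_def C_def by (intro compact_Int_closed compact_Times compact_Icc)
  have h: "continuous_on Q h"
    unfolding h_def case_prod_beta
    by (intro continuous_intros continuous_on_compose2[OF T(1)]) (auto simp: Q_def C_def)
  have pos: "h z > 0" if "z \<in> Q" for z
  proof (rule ccontr)
    assume "\<not> h z > 0"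
    moreover obtain a b c d where z: "z = (a, b, c, d)" by (cases z)
    ultimately have "T c \<le> a" "b \<le> T d" by (auto simp: h_def)
    moreover have "l \<le> a" "b \<le> u" "c \<in> {a..b}" "d \<in> {a..b}" using that z by (auto simp: Q_def C_def)
    ultimately have "a = p \<and> b = p" by (intro expanding_interval_trivial[OF T per])
    then show False using that z \<open>\<epsilon> > 0\<close> by (auto simp: Q_def)
  qed
  obtain m where "m > 0" and m: "\<And>z. z \<in> Q \<Longrightarrow> m \<le> h z"
  proof (cases "Q = {}")
    case True
    \<comment> \<open>Without bad configurations no minimum exists, and any positive value
      serves.\<close>
    show ?thesis by (rule that[of 1]) (use True in auto)
  next
    case False
    from continuous_attains_inf[OF Q False h] pos that show ?thesis by metis
  qed
  show ?thesis
  proof (rule that)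
    \<comment> \<open>Half of the lower bound, so that \<open>h \<le> m / 2 < m\<close> rules out
      membership in \<open>Q\<close>.\<close>
    show "m / 2 > 0" using \<open>m > 0\<close> by simp
    fix a b c d
    assume *: "l \<le> a" "b \<le> u" "c \<in> {a..b}" "d \<in> {a..b}" "T c \<le> a + m / 2" "b \<le> T d + m / 2"
    then have "h (a, b, c, d) \<le> m / 2" by (simp only: h_def prod.case max.bounded_iff) (intro conjI; linarith)
    with m[of "(a, b, c, d)"] \<open>m > 0\<close> have "(a, b, c, d) \<notin> Q" by force
    then show "{a..b} \<subseteq> {p - \<epsilon>..p + \<epsilon>}" using * by (auto simp: Q_def C_def)
  qed
qed

section \<open>Invariant measures of an interval map\<close>

text \<open>This is the uniform law on the orbit of \<open>x\<close>, a point mass if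
  \<open>T x = x\<close>; \<open>T\<close> permutes the orbit and so preserves it. The map that
  fixes the orbit and sends all else to \<open>x\<close> carries the law from the full type into
  \<open>S\<close>.\<close>

lemma invariant_prob_2_cycle:
  assumes "T ` S \<subseteq> S" "x \<in> S" "T (T x) = x" and T: "T \<in> borel_on S \<rightarrow>\<^sub>M borel_on S"
  shows "invariant_prob S T (distr (measure_pmf (pmf_of_set {x, T x})) (borel_on S) (\<lambda>y. if y \<in> {x, T x} then y else x))"
    (is "invariant_prob S T ?M")
proof -
  let ?p = "pmf_of_set {x, T x}" and ?j = "\<lambda>y. if y \<in> {x, T x} then y else x"
  have Tx: "T x \<in> S" using assms by auto
  have j: "?j \<in> measure_pmf ?p \<rightarrow>\<^sub>M borel_on S" using assms(2) Tx by auto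
  have "distr ?M ?M T = distr ?M (borel_on S) T" by (rule distr_cong) auto
  also have "\<dots> = distr (measure_pmf ?p) (borel_on S) (T \<circ> ?j)" by (rule distr_distr[OF T j])
  \<comment> \<open>On the support \<open>?j\<close> is the identity and \<open>T\<close> stays in
    the support, so the two compositions agree there.\<close>
  also have "\<dots> = distr (measure_pmf ?p) (borel_on S) (?j \<circ> T)"
    by (rule distr_cong_AE) (use assms Tx in \<open>auto simp: AE_measure_pmf_iff set_pmf_of_set\<close>)
  also have "\<dots> = distr (distr (measure_pmf ?p) (count_space UNIV) T) (borel_on S) ?j"
    by (subst distr_distr) (use assms(2) Tx in auto)
  also have "distr (measure_pmf ?p) (count_space UNIV) T = measure_pmf (map_pmf T ?p)"
    by (simp add: map_pmf_rep_eq)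
  also have "map_pmf T ?p = pmf_of_set (T ` {x, T x})"
    by (rule map_pmf_of_set_inj) (use assms in \<open>auto simp: inj_on_def\<close>)
  also have "T ` {x, T x} = {x, T x}" using assms by auto
  finally have "distr ?M ?M T = ?M" .
  then show ?thesis
    unfolding invariant_prob_def
    using j T by (auto intro!: prob_space.prob_space_distr measure_pmf.prob_space_axioms)
qed

text \<open>The point mass at a fixed point \<open>p\<close> is invariant, so it is
  \<open>\<nu>\<close>. The uniform law on any orbit of period at most 2 must coincide with it,
  which puts that orbit at \<open>p\<close>.\<close>

lemma uniquely_ergodic_interval_map:
  assumes T: "continuous_on I T" "T ` I \<subseteq> I" and inv: "invariant_prob I T \<nu>"
    and uniq: "\<And>\<nu>'. invariant_prob I T \<nu>' \<Longrightarrow> \<nu>' = \<nu>"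
  obtains p where "p \<in> I" "\<nu> = return (borel_on I) p" "\<And>x. x \<in> I \<Longrightarrow> T (T x) = x \<Longrightarrow> x = p"
proof -
  have Tm: "T \<in> borel_on I \<rightarrow>\<^sub>M borel_on I" using T by (rule measurable_borel_on_continuous_on)
  have "-1 \<le> T (-1)" "T 1 \<le> 1" using T(2) by (simp_all add: image_subset_iff)
  then obtain p where p: "-1 \<le> p" "p \<le> 1" "T p = p"
    using fixed_point_in_segment[OF T(1)] by auto
  let ?R = "return (borel_on I) p"
  have "distr ?R ?R T = distr ?R (borel_on I) T" by (rule distr_cong) auto
  also have "\<dots> = ?R" using distr_return[OF Tm, of p] p by simp
  finally have "invariant_prob I T ?R"
    unfolding invariant_prob_def using Tm p by (simp add: prob_space_return)
  then have \<nu>: "\<nu> = return (borel_on I) p" by (rule uniq[symmetric])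
  have cycle: "x = p" if x: "x \<in> I" "T (T x) = x" for x
  proof -
    let ?j = "\<lambda>y. if y \<in> {x, T x} then y else x"
    have Tx: "T x \<in> I" using T(2) x(1) by blast
    have \<nu>': "\<nu> = distr (measure_pmf (pmf_of_set {x, T x})) (borel_on I) ?j"
      by (rule uniq[symmetric, OF invariant_prob_2_cycle[OF T(2) x Tm]])
    have "{p} \<in> sets (borel_on I)" "{y \<in> space (borel_on I). y = p} = {p}"
      using p by (auto simp: sets_restrict_space_iff)
    then have eqp: "{y \<in> space (borel_on I). y = p} \<in> sets (borel_on I)" by simp
    \<comment> \<open>Both descriptions of \<open>\<nu>\<close> are compared: the point mass charges
      only \<open>p\<close>, while the uniform law gives \<open>x\<close> positive mass.\<close>
    then have "AE y in \<nu>. y = p"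
      unfolding \<nu> using p by (subst AE_return) (auto simp: pred_def)
    then have "AE y in measure_pmf (pmf_of_set {x, T x}). ?j y = p"
      unfolding \<nu>' using x Tx by (subst (asm) AE_distr_iff[OF _ eqp]) auto
    then show ?thesis by (auto simp: AE_measure_pmf_iff set_pmf_of_set)
  qed
  show ?thesis by (rule that[OF _ \<nu> cycle]) (use p in auto)
qed

section \<open>Concentration of measures invariant under \<open>Theta\<close>\<close>

text \<open>Under an invariant law \<open>T z\<close> is distributed as \<open>z\<close>, so a bound
  that holds on images holds almost everywhere.\<close>

lemma invariant_prob_AE:
  assumes inv: "invariant_prob S T M" and P: "{z \<in> S. P z} \<in> sets (borel_on S)"
    and AE: "AE z in M. P (T z)"
  shows "AE z in M. P z"
proof -
  have sets: "sets M = sets (borel_on S)" and T: "T \<in> M \<rightarrow>\<^sub>M M" "distr M M T = M"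
    using inv by (auto simp: invariant_prob_def)
  then have "{z \<in> space M. P z} \<in> sets M"
    using P sets_eq_imp_space_eq[OF sets] by simp
  from AE_distr_iff[OF T(1) this] AE show ?thesis unfolding T(2) by blast
qed

text \<open>The coordinates of an image point differ by \<open>(1 - k) * (T2 y - T1 x)\<close>, and
  \<open>I\<close> has length 2.\<close>

lemma Theta_concentrates_at_diagonal:
  assumes T: "T1 ` I \<subseteq> I" "T2 ` I \<subseteq> I" and k: "k \<le> 1"
    and inv: "invariant_prob (I \<times> I) (Theta T1 T2 k) M"
  shows "AE z in M. dist (snd z) (fst z) \<le> 2 * (1 - k)"
proof (rule invariant_prob_AE[OF inv])
  show "{z \<in> I \<times> I. dist (snd z) (fst z) \<le> 2 * (1 - k)} \<in> sets (borel_on (I \<times> I))"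
    by (intro pred_borel_on_le continuous_intros)
  have sp: "space M = I \<times> I"
    using inv sets_eq_imp_space_eq[of M "borel_on (I \<times> I)"] by (auto simp: invariant_prob_def)
  show "AE z in M. dist (snd (Theta T1 T2 k z)) (fst (Theta T1 T2 k z)) \<le> 2 * (1 - k)"
  proof (rule AE_I2)
    fix z assume "z \<in> space M"
    then obtain x y where z: "z = (x, y)" "x \<in> I" "y \<in> I" by (auto simp: sp)
    then have "T1 x \<in> I" "T2 y \<in> I" using T by blast+
    then have "\<bar>T2 y - T1 x\<bar> \<le> 2" by auto
    then have "(1 - k) * \<bar>T2 y - T1 x\<bar> \<le> (1 - k) * 2" using k by (intro mult_left_mono) auto
    moreover have "snd (Theta T1 T2 k z) - fst (Theta T1 T2 k z) = (1 - k) * (T2 y - T1 x)"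
      by (simp add: Theta_def z algebra_simps)
    ultimately show "dist (snd (Theta T1 T2 k z)) (fst (Theta T1 T2 k z)) \<le> 2 * (1 - k)"
      using k by (simp add: dist_real_def abs_mult mult.commute)
  qed
qed

text \<open>The second coordinate of an image point is within \<open>2 * k\<close> of
  \<open>T2 y\<close>. With \<open>y\<close> in the essential range \<open>{a..b}\<close>,
  invariance makes \<open>T2 c - 2 * k\<close> and \<open>T2 d + 2 * k\<close> almost sure bounds,
  and \<open>a\<close>, \<open>b\<close> are the optimal ones.\<close>

lemma Theta_essential_range:
  assumes T1: "T1 ` I \<subseteq> I" and T2: "continuous_on I T2" "T2 ` I \<subseteq> I" and k: "0 \<le> k"
    and inv: "invariant_prob (I \<times> I) (Theta T1 T2 k) M"
  obtains a b c d where "-1 \<le> a" "b \<le> 1" "c \<in> {a..b}" "d \<in> {a..b}" "T2 c \<le> a + 2 * k" "b \<le> T2 d + 2 * k"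
    "AE z in M. snd z \<in> {a..b}"
proof -
  interpret prob_space M using inv by (simp add: invariant_prob_def)
  have sp: "space M = I \<times> I"
    using inv sets_eq_imp_space_eq[of M "borel_on (I \<times> I)"] by (auto simp: invariant_prob_def)
  have I: "AE z in M. -1 \<le> snd z" "AE z in M. snd z \<le> 1"
    by (rule AE_I2; auto simp: sp)+
  obtain a where a: "AE z in M. a \<le> snd z" "\<And>a'. AE z in M. a' \<le> snd z \<Longrightarrow> a' \<le> a"
    using essential_infimum_exists[OF prob_space_axioms I] by metis
  \<comment> \<open>The essential supremum is obtained as minus the essential infimum of
    \<open>- snd z\<close>.\<close>
  have I': "AE z in M. -1 \<le> - snd z" "AE z in M. - snd z \<le> 1"
    using I by auto
  obtain b' where b': "AE z in M. b' \<le> - snd z" "\<And>a'. AE z in M. a' \<le> - snd z \<Longrightarrow> a' \<le> b'"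
    using essential_infimum_exists[OF prob_space_axioms I'] by metis
  define b where "b = - b'"
  have b: "AE z in M. snd z \<le> b"
    using b'(1) by eventually_elim (simp add: b_def)
  have range: "AE z in M. snd z \<in> {a..b}" using a(1) b by eventually_elim simp
  have a1: "-1 \<le> a" using a(2) I(1) by blast
  have b1: "b \<le> 1" using b'(2)[OF I'(1)] by (simp add: b_def)
  have "AE z in M. a \<le> b" using range by eventually_elim simp
  then have ab: "a \<le> b" by simp
  have ab_ne: "{a..b} \<noteq> {}" using ab by simp
  have cont: "continuous_on {a..b} T2"
    by (rule continuous_on_subset[OF T2(1)]) (use a1 b1 in auto)
  \<comment> \<open>The extrema of \<open>T2\<close> on \<open>{a..b}\<close> are attained, at
    \<open>c\<close> and \<open>d\<close>, so the image of \<open>{a..b}\<close> has convex hull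
    \<open>{T2 c..T2 d}\<close>.\<close>
  obtain c where c: "c \<in> {a..b}" "\<And>y. y \<in> {a..b} \<Longrightarrow> T2 c \<le> T2 y"
    using continuous_attains_inf[OF compact_Icc ab_ne cont] by blast
  obtain d where d: "d \<in> {a..b}" "\<And>y. y \<in> {a..b} \<Longrightarrow> T2 y \<le> T2 d"
    using continuous_attains_sup[OF compact_Icc ab_ne cont] by blast
  have near: "\<bar>snd (Theta T1 T2 k z) - T2 (snd z)\<bar> \<le> 2 * k" if zM: "z \<in> space M" for z
  proof -
    obtain x y where z: "z = (x, y)" "x \<in> I" "y \<in> I" using zM by (auto simp: sp)
    then have "T1 x \<in> I" "T2 y \<in> I" using T1 T2(2) by blast+
    then have "\<bar>T1 x - T2 y\<bar> \<le> 2" by auto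
    then have "k * \<bar>T1 x - T2 y\<bar> \<le> k * 2" using k by (intro mult_left_mono) auto
    moreover have "snd (Theta T1 T2 k z) - T2 (snd z) = k * (T1 x - T2 y)"
      by (simp add: Theta_def z algebra_simps)
    ultimately show ?thesis using k by (simp add: abs_mult mult.commute)
  qed
  have "AE z in M. T2 c - 2 * k \<le> snd z"
  proof (rule invariant_prob_AE[OF inv])
    show "{z \<in> I \<times> I. T2 c - 2 * k \<le> snd z} \<in> sets (borel_on (I \<times> I))"
      by (intro pred_borel_on_le continuous_intros)
    have "AE z in M. z \<in> space M" by simp
    then show "AE z in M. T2 c - 2 * k \<le> snd (Theta T1 T2 k z)"
      using range by eventually_elim (use near c(2) in \<open>force simp: abs_le_iff\<close>)
  qed
  then have "T2 c \<le> a + 2 * k" using a(2) by force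
  moreover have "AE z in M. snd z \<le> T2 d + 2 * k"
  proof (rule invariant_prob_AE[OF inv])
    show "{z \<in> I \<times> I. snd z \<le> T2 d + 2 * k} \<in> sets (borel_on (I \<times> I))"
      by (intro pred_borel_on_le continuous_intros)
    have "AE z in M. z \<in> space M" by simp
    then show "AE z in M. snd (Theta T1 T2 k z) \<le> T2 d + 2 * k"
      using range by eventually_elim (use near d(2) in \<open>force simp: abs_le_iff\<close>)
  qed
  then have "AE z in M. - (T2 d + 2 * k) \<le> - snd z" by eventually_elim simp
  then have "b \<le> T2 d + 2 * k" using b'(2) by (force simp: b_def)
  ultimately show ?thesis using that a1 b1 c(1) d(1) range by blast
qed

lemma Theta_concentrates_at_fixed_point:
  assumes T1: "T1 ` I \<subseteq> I" and T2: "continuous_on I T2" "T2 ` I \<subseteq> I"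
    and per: "\<And>x. x \<in> I \<Longrightarrow> T2 (T2 x) = x \<Longrightarrow> x = p"
    and inv: "\<And>k. k \<in> {0..1} \<Longrightarrow> invariant_prob (I \<times> I) (Theta T1 T2 k) (\<rho> k)"
    and "\<epsilon> > 0"
  shows "\<forall>\<^sub>F k in at_right 0. AE z in \<rho> k. dist (snd z) p \<le> \<epsilon>"
proof -
  obtain \<delta> where "\<delta> > 0" and \<delta>: "\<And>a b c d. -1 \<le> a \<Longrightarrow> b \<le> 1 \<Longrightarrow> c \<in> {a..b} \<Longrightarrow> d \<in> {a..b} \<Longrightarrow>
      T2 c \<le> a + \<delta> \<Longrightarrow> b \<le> T2 d + \<delta> \<Longrightarrow> {a..b} \<subseteq> {p - \<epsilon>..p + \<epsilon>}"
    using almost_expanding_interval_small[OF T2 per \<open>\<epsilon> > 0\<close>] by metis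
  \<comment> \<open>The bound 1 keeps \<open>k\<close> where invariance is assumed, and
    \<open>\<delta> / 2\<close> makes the error \<open>2 * k\<close> smaller than
    \<open>\<delta>\<close>.\<close>
  have "AE z in \<rho> k. dist (snd z) p \<le> \<epsilon>" if k: "0 < k" "k < min 1 (\<delta> / 2)" for k
  proof -
    have "invariant_prob (I \<times> I) (Theta T1 T2 k) (\<rho> k)" using inv k by simp
    with T1 T2 obtain a b c d where *: "-1 \<le> a" "b \<le> 1" "c \<in> {a..b}" "d \<in> {a..b}"
      "T2 c \<le> a + 2 * k" "b \<le> T2 d + 2 * k" and AE: "AE z in \<rho> k. snd z \<in> {a..b}"
      using k by (elim Theta_essential_range[rotated 4]) auto
    have "{a..b} \<subseteq> {p - \<epsilon>..p + \<epsilon>}" by (rule \<delta>[OF *(1-4)]) (use * k in linarith)+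
    with AE show ?thesis
      by (elim eventually_mono) (auto simp: dist_real_def abs_le_iff subset_iff algebra_simps)
  qed
  then show ?thesis
    using \<open>\<delta> > 0\<close> unfolding eventually_at_right_field by (intro exI[of _ "min 1 (\<delta> / 2)"]) auto
qed

section \<open>The limits at \<open>k = 1\<close> and \<open>k = 0\<close>\<close>

text \<open>The concentration lemma yields its limit as a law on a graph, while the claim names a
  product measure. Weak convergence sees the limit only through integrals of test functions, so
  matching those is enough.\<close>

lemma integral_pair_return:
  fixes S :: "'a::second_countable_topology set" and f :: "'a \<times> 'a \<Rightarrow> real"
  assumes \<mu>: "prob_space \<mu>" "sets \<mu> = sets (borel_on S)" and p: "p \<in> S"
    and f: "continuous_on (S \<times> S) f" "bounded (f ` (S \<times> S))"
  shows "(\<integral>z. f z \<partial>(\<mu> \<Otimes>\<^sub>M return (borel_on S) p)) =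
    (\<integral>z. f z \<partial>distr \<mu> (borel_on (S \<times> S)) (\<lambda>x. (x, p)))"
proof -
  let ?R = "return (borel_on S) p"
  interpret \<mu>: prob_space \<mu> by fact
  interpret R: prob_space ?R using p by (simp add: prob_space_return)
  interpret P: pair_prob_space \<mu> ?R ..
  have sp: "space \<mu> = S" using sets_eq_imp_space_eq[OF \<mu>(2)] by simp
  have fm: "f \<in> borel_measurable (borel_on (S \<times> S))"
    using f by (intro borel_measurable_continuous_on_restrict) auto
  have "sets (\<mu> \<Otimes>\<^sub>M ?R) = sets (borel_on S \<Otimes>\<^sub>M borel_on S)" using \<mu>(2) by simp
  then have fP: "f \<in> borel_measurable (\<mu> \<Otimes>\<^sub>M ?R)"
    using measurable_compose[OF measurable_ident_borel_on_Times fm] measurable_cong_sets by blast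
  obtain B where B: "\<And>z. z \<in> S \<times> S \<Longrightarrow> norm (f z) \<le> B"
    using f(2) by (auto simp: bounded_iff)
  have graph: "(\<lambda>x. (x, p)) \<in> borel_on S \<rightarrow>\<^sub>M borel_on (S \<times> S)"
    using p by (intro measurable_borel_on_continuous_on continuous_intros) auto
  then have graph': "(\<lambda>x. (x, p)) \<in> \<mu> \<rightarrow>\<^sub>M borel_on (S \<times> S)"
    using measurable_cong_sets[OF \<mu>(2) refl] by blast
  have "integrable (\<mu> \<Otimes>\<^sub>M ?R) f"
    by (rule P.integrable_const_bound[where B = B]) (use B fP in \<open>auto simp: space_pair_measure sp\<close>)
  then have "(\<integral>z. f z \<partial>(\<mu> \<Otimes>\<^sub>M ?R)) = (\<integral>x. (\<integral>y. f (x, y) \<partial>?R) \<partial>\<mu>)"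
    by (simp add: P.integral_fst')
  also have "\<dots> = (\<integral>x. f (x, p) \<partial>\<mu>)"
  proof (rule Bochner_Integration.integral_cong[OF refl])
    fix x assume "x \<in> space \<mu>"
    then have "(\<lambda>y. (x, y)) \<in> borel_on S \<rightarrow>\<^sub>M borel_on (S \<times> S)"
      by (intro measurable_borel_on_continuous_on continuous_intros) (auto simp: sp)
    from measurable_compose[OF this fm] p show "(\<integral>y. f (x, y) \<partial>?R) = f (x, p)"
      by (intro integral_return) auto
  qed
  also have "\<dots> = (\<integral>z. f z \<partial>distr \<mu> (borel_on (S \<times> S)) (\<lambda>x. (x, p)))"
    by (rule integral_distr[OF graph' fm, symmetric])
  finally show ?thesis .
qed

theorem proposition6:
  fixes T1 T2 :: "real \<Rightarrow> real"
    and \<mu> :: "real measure"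
    and \<rho> :: "real \<Rightarrow> (real \<times> real) measure"
    and \<Omega> :: "real \<Rightarrow> 'w measure"
    and \<eta>1 \<eta>2 :: "real \<Rightarrow> 'w \<Rightarrow> real"
    and K :: "real \<Rightarrow> real \<Rightarrow> real measure"
  assumes "continuous_on I T1" and "T1 ` I \<subseteq> I"
    and "continuous_on I T2" and "T2 ` I \<subseteq> I"
    and "invariant_prob I T1 \<mu>"
    and "\<And>k. k \<in> {0..1} \<Longrightarrow> invariant_prob (I \<times> I) (Theta T1 T2 k) (\<rho> k)"
    and "\<And>k. k \<in> {0..1} \<Longrightarrow> distr (\<rho> k) (borel_on I) fst = \<mu>"
    and "\<And>k. k \<in> {0..1} \<Longrightarrow> prob_space (\<Omega> k)"
    and "\<And>k. k \<in> {0..1} \<Longrightarrow> (\<lambda>\<omega>. (\<eta>1 k \<omega>, \<eta>2 k \<omega>)) \<in> \<Omega> k \<rightarrow>\<^sub>M borel_on (I \<times> I)"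
    and "\<And>k. k \<in> {0..1} \<Longrightarrow> distr (\<Omega> k) (borel_on (I \<times> I)) (\<lambda>\<omega>. (\<eta>1 k \<omega>, \<eta>2 k \<omega>)) = \<rho> k"
    and "\<And>k. k \<in> {0..1} \<Longrightarrow> regular_cond_distr \<mu> (\<rho> k) (K k)"
  shows "(\<exists>D. prob_space D \<and> sets D = sets (borel_on (I \<times> I)) \<and>
            (\<forall>A \<in> sets (borel_on (I \<times> I)). measure D A = measure \<mu> {x \<in> I. (x, x) \<in> A}) \<and>
            conv_in_distr_on (I \<times> I) \<Omega> (\<lambda>k \<omega>. (\<eta>1 k \<omega>, \<eta>2 k \<omega>)) D (at_left 1))
       \<and> kernels_conv_on I \<mu> K (\<lambda>x. return (borel_on I) x) (at_left 1)
       \<and> (\<forall>\<nu>. invariant_prob I T2 \<nu> \<and> (\<forall>\<nu>'. invariant_prob I T2 \<nu>' \<longrightarrow> \<nu>' = \<nu>) \<longrightarrow>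
            weak_conv_on (I \<times> I) \<rho> (\<mu> \<Otimes>\<^sub>M \<nu>) (at_right 0) \<and>
            kernels_conv_on I \<mu> K (\<lambda>_. \<nu>) (at_right 0))"
proof (intro conjI allI impI)
  have \<mu>: "prob_space \<mu>" "sets \<mu> = sets (borel_on I)"
    using assms(5) by (auto simp: invariant_prob_def)
  interpret \<mu>: prob_space \<mu> by fact
  have sp: "space \<mu> = I" using sets_eq_imp_space_eq[OF \<mu>(2)] by simp
  \<comment> \<open>Nothing is assumed about \<open>\<rho> k\<close> for \<open>k\<close> outside
    \<open>{0..1}\<close>; both one-sided filters eventually stay inside.\<close>
  have left: "\<forall>\<^sub>F k in at_left 1. k \<in> {0..1::real}"
    unfolding eventually_at_left_field by (intro exI[of _ 0]) auto
  have right: "\<forall>\<^sub>F k in at_right 0. k \<in> {0..1::real}"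
    unfolding eventually_at_right_field by (intro exI[of _ 1]) auto
  have marg: "prob_space (\<rho> k) \<and> sets (\<rho> k) = sets (borel_on (I \<times> I)) \<and> distr (\<rho> k) (borel_on I) fst = \<mu>"
    and ker: "prob_space (\<rho> k) \<and> sets (\<rho> k) = sets (borel_on (I \<times> I)) \<and> regular_cond_distr \<mu> (\<rho> k) (K k)"
    if "k \<in> {0..1}" for k
    using that assms(6,7,11)[OF that] by (auto simp: invariant_prob_def)
  have diag: "\<forall>\<^sub>F k in at_left 1. AE z in \<rho> k. dist (snd z) (fst z) \<le> \<epsilon>" if "\<epsilon> > 0" for \<epsilon>
  proof -
    have "\<forall>\<^sub>F k in at_left 1. k > 1 - \<epsilon> / 2"
      unfolding eventually_at_left_field using that by (intro exI[of _ "1 - \<epsilon> / 2"]) auto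
    with left show ?thesis
    proof eventually_elim
      case (elim k)
      then have "AE z in \<rho> k. dist (snd z) (fst z) \<le> 2 * (1 - k)"
        using assms(2,4,6) by (intro Theta_concentrates_at_diagonal[where ?T1.0 = T1 and ?T2.0 = T2]) auto
      moreover have "2 * (1 - k) \<le> \<epsilon>" using elim by (simp add: field_simps)
      ultimately show ?case by (auto elim: eventually_mono)
    qed
  qed
  \<comment> \<open>The witness for the limit law is the push-forward of \<open>\<mu>\<close> along
    the diagonal.\<close>
  let ?D = "distr \<mu> (borel_on (I \<times> I)) (\<lambda>x. (x, x))"
  have "weak_conv_on (I \<times> I) \<rho> ?D (at_left 1)"
    by (rule weak_conv_on_concentrating[where g = "\<lambda>x. x"])
       (use eventually_mono[OF left marg] diag in auto)
  moreover have "\<forall>\<^sub>F k in at_left 1. distr (\<Omega> k) (borel_on (I \<times> I)) (\<lambda>\<omega>. (\<eta>1 k \<omega>, \<eta>2 k \<omega>)) = \<rho> k"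
    using left by eventually_elim (rule assms(10))
  ultimately have "conv_in_distr_on (I \<times> I) \<Omega> (\<lambda>k \<omega>. (\<eta>1 k \<omega>, \<eta>2 k \<omega>)) ?D (at_left 1)"
    unfolding conv_in_distr_on_def by (rule weak_conv_on_cong_eventually)
  moreover have diag_meas: "(\<lambda>x. (x, x)) \<in> \<mu> \<rightarrow>\<^sub>M borel_on (I \<times> I)"
  proof -
    have "(\<lambda>x. (x, x)) \<in> borel_on I \<rightarrow>\<^sub>M borel_on (I \<times> I)"
      by (intro measurable_borel_on_continuous_on continuous_intros) auto
    then show ?thesis using measurable_cong_sets[OF \<mu>(2) refl] by blast
  qed
  moreover have "measure ?D A = measure \<mu> {x \<in> I. (x, x) \<in> A}" if "A \<in> sets (borel_on (I \<times> I))" for A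
  proof -
    have "(\<lambda>x. (x, x)) -` A \<inter> space \<mu> = {x \<in> I. (x, x) \<in> A}" by (auto simp: sp)
    then show ?thesis using measure_distr[OF diag_meas that] by simp
  qed
  ultimately show "\<exists>D. prob_space D \<and> sets D = sets (borel_on (I \<times> I)) \<and>
      (\<forall>A \<in> sets (borel_on (I \<times> I)). measure D A = measure \<mu> {x \<in> I. (x, x) \<in> A}) \<and>
      conv_in_distr_on (I \<times> I) \<Omega> (\<lambda>k \<omega>. (\<eta>1 k \<omega>, \<eta>2 k \<omega>)) D (at_left 1)"
    by (intro exI[of _ ?D] conjI ballI) (auto intro: \<mu>.prob_space_distr)
  show "kernels_conv_on I \<mu> K (\<lambda>x. return (borel_on I) x) (at_left 1)"
    by (rule kernels_conv_on_concentrating[OF \<mu>, where g = "\<lambda>x. x"])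
       (use eventually_mono[OF left ker] diag in auto)
  fix \<nu> assume "invariant_prob I T2 \<nu> \<and> (\<forall>\<nu>'. invariant_prob I T2 \<nu>' \<longrightarrow> \<nu>' = \<nu>)"
  then obtain p where p: "p \<in> I" and \<nu>: "\<nu> = return (borel_on I) p"
    and per: "\<And>x. x \<in> I \<Longrightarrow> T2 (T2 x) = x \<Longrightarrow> x = p"
    using uniquely_ergodic_interval_map[OF assms(3,4)] by metis
  have conc: "\<forall>\<^sub>F k in at_right 0. AE z in \<rho> k. dist (snd z) p \<le> \<epsilon>" if "\<epsilon> > 0" for \<epsilon>
    by (rule Theta_concentrates_at_fixed_point[OF assms(2,3,4) per assms(6) that])
  \<comment> \<open>Here the limiting graph is the horizontal line at height \<open>p\<close>, since
    \<open>\<nu>\<close> is the point mass at \<open>p\<close>.\<close>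
  have "weak_conv_on (I \<times> I) \<rho> (distr \<mu> (borel_on (I \<times> I)) (\<lambda>x. (x, p))) (at_right 0)"
    by (rule weak_conv_on_concentrating[where g = "\<lambda>_. p"])
       (use eventually_mono[OF right marg] conc p in auto)
  then show "weak_conv_on (I \<times> I) \<rho> (\<mu> \<Otimes>\<^sub>M \<nu>) (at_right 0)"
    unfolding weak_conv_on_def \<nu> using integral_pair_return[OF \<mu> p] by simp
  show "kernels_conv_on I \<mu> K (\<lambda>_. \<nu>) (at_right 0)"
    unfolding \<nu>
    by (rule kernels_conv_on_concentrating[OF \<mu>, where g = "\<lambda>_. p"])
       (use eventually_mono[OF right ker] conc p in auto)
qed

end
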